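(* Let $X$ be a set, let $d$ be a metric on $X$, let $n \ge 1$, and let $S_1,\ldots,S_n$ be nonempty finite subsets of $X$. For $x=(x_1,\ldots,x_n)$ with $x_i \in S_i$ for all $i$, define the similar elements objective $$c(x) = \sum_{1 \le i,j \le n} d(x_i,x_j)$$ (sum over all ordered pairs $(i,j)$), and let $x^*$ be a minimizer of $c$ over $S_1\times\cdots\times S_n$. For each $1 \le r \le n$ define $$c^r(x) = \sum_{j \neq r} d(x_r,x_j).$$ Consider the following algorithm. For each $1\le r\le n$, compute $x^r=(x^r_1,\ldots,x^r_n)\in S_1\times\cdots\times S_n$ by $$x^r_r \in \operatorname{argmin}_{x_r \in S_r} \sum_{j \neq r} \min_{x_j \in S_j} d(x_r,x_j), \qquad x^r_j \in \operatorname{argmin}_{x_j \in S_j} d(x^r_r,x_j)\ \ (j\neq r),$$ with ties broken arbitrarily. Then choose $\hat{r} \in \operatorname{argmin}_{1 \le r \le n} c^r(x^r)$ (ties broken arbitrarily) and output $\hat{x} = x^{\hat r}$. Then the output satisfies $$c(\hat{x}) \le 2\, c(x^* ).$$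
   Context: This is the "similar elements" problem: select one element from each set $S_i$ so that the selected elements are close to each other under $d$, measured by the sum of pairwise distances $c(x)$. Each $c^r$ is the "star-graph" objective keeping only the terms of $c$ that involve $x_r$; the stated procedure computes a minimizer $x^r$ of $c^r$ over $S_1\times\cdots\times S_n$. *)

theory Defs
  imports "HOL-Analysis.Abstract_Metric_Spaces" "HOL-Library.FuncSet"
begin

definition similarity_cost :: "('a \<Rightarrow> 'a \<Rightarrow> real) \<Rightarrow> nat \<Rightarrow> (nat \<Rightarrow> 'a) \<Rightarrow> real" where
  "similarity_cost d n x = (\<Sum>i\<in>{1..n}. \<Sum>j\<in>{1..n}. d (x i) (x j))"

definition star_cost :: "('a \<Rightarrow> 'a \<Rightarrow> real) \<Rightarrow> nat \<Rightarrow> nat \<Rightarrow> (nat \<Rightarrow> 'a) \<Rightarrow> real" where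
  "star_cost d n r x = (\<Sum>j\<in>{1..n} - {r}. d (x r) (x j))"

text \<open>The algorithm breaks ties arbitrarily, so it is modelled by relations: the first holds if
  \<open>x\<close> is a possible choice in iteration \<open>r\<close>, the second if \<open>x\<close> is a possible final output.\<close>

definition star_choice ::
  "('a \<Rightarrow> 'a \<Rightarrow> real) \<Rightarrow> nat \<Rightarrow> (nat \<Rightarrow> 'a set) \<Rightarrow> nat \<Rightarrow> (nat \<Rightarrow> 'a) \<Rightarrow> bool" where
  "star_choice d n S r x \<longleftrightarrow>
     x \<in> Pi\<^sub>E {1..n} S \<and>
     is_arg_min (\<lambda>a. \<Sum>j\<in>{1..n} - {r}. Min ((\<lambda>b. d a b) ` S j)) (\<lambda>a. a \<in> S r) (x r) \<and>
     (\<forall>j\<in>{1..n} - {r}. is_arg_min (\<lambda>b. d (x r) b) (\<lambda>b. b \<in> S j) (x j))"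

definition algorithm_output ::
  "('a \<Rightarrow> 'a \<Rightarrow> real) \<Rightarrow> nat \<Rightarrow> (nat \<Rightarrow> 'a set) \<Rightarrow> (nat \<Rightarrow> 'a) \<Rightarrow> bool" where
  "algorithm_output d n S x \<longleftrightarrow>
     (\<exists>xs r. (\<forall>q\<in>{1..n}. star_choice d n S q (xs q)) \<and>
             is_arg_min (\<lambda>q. star_cost d n q (xs q)) (\<lambda>q. q \<in> {1..n}) r \<and>
             x = xs r)"

end

(* The cost c is the sum over r of the star costs c^r, and x^r minimizes c^r, so the smallest of
   the values c^r(x^r) is at most their average over r, which is at most c(x_opt) / n.  Conversely,
   routing every pair (i, j) through the centre r gives c <= 2 n c^r by the triangle inequality. *)

theory Submission
  imports Defs
begin

text \<open>Once the centre is fixed, the terms of the star cost involve distinct coordinates and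
  can be minimized independently. Minimizing over the centre the sum of these separate minima
  therefore minimizes the star cost over the whole product.\<close>

lemma star_choice_minimizes:
  assumes choice: "star_choice d n S r x"
    and y: "y \<in> Pi\<^sub>E {1..n} S"
    and r: "r \<in> {1..n}"
    and fin: "\<And>j. j \<in> {1..n} \<Longrightarrow> finite (S j)"
  shows "star_cost d n r x \<le> star_cost d n r y"
proof -
  have x_min: "\<And>j b. j \<in> {1..n} - {r} \<Longrightarrow> x j \<in> S j \<and> (b \<in> S j \<longrightarrow> d (x r) (x j) \<le> d (x r) b)"
    and centre: "\<And>a. a \<in> S r \<Longrightarrow> (\<Sum>j\<in>{1..n} - {r}. Min (d (x r) ` S j))
      \<le> (\<Sum>j\<in>{1..n} - {r}. Min (d a ` S j))"
    using choice unfolding star_choice_def is_arg_min_linorder by blast+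
  have y_in: "y j \<in> S j" if "j \<in> {1..n}" for j
    using y that by (rule PiE_mem)
  have "star_cost d n r x \<le> (\<Sum>j\<in>{1..n} - {r}. Min (d (x r) ` S j))"
    unfolding star_cost_def
  proof (rule sum_mono)
    fix j assume "j \<in> {1..n} - {r}"
    \<comment> \<open>\<open>Min\<close> needs a nonempty set; this is not assumed of
      \<open>S j\<close>, but \<open>x j\<close> witnesses it.\<close>
    then show "d (x r) (x j) \<le> Min (d (x r) ` S j)"
      using x_min[of j] fin[of j] by (subst Min_ge_iff) auto
  qed
  also have "\<dots> \<le> (\<Sum>j\<in>{1..n} - {r}. Min (d (y r) ` S j))"
    using centre y_in r by blast
  also have "\<dots> \<le> star_cost d n r y"
    unfolding star_cost_def using fin y_in by (intro sum_mono Min_le) auto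
  finally show ?thesis .
qed

context Metric_space
begin

text \<open>The extra term is \<open>d (x r) (x r)\<close>, which vanishes because
  \<open>x r\<close> lies in \<open>M\<close>.\<close>

lemma star_cost_eq_sum:
  assumes "x r \<in> M" "r \<in> {1..n}"
  shows "star_cost d n r x = (\<Sum>j\<in>{1..n}. d (x r) (x j))"
  using assms by (simp add: star_cost_def sum.remove)

lemma similarity_cost_eq_sum_star_cost:
  assumes "x \<in> {1..n} \<rightarrow> M"
  shows "similarity_cost d n x = (\<Sum>r\<in>{1..n}. star_cost d n r x)"
  unfolding similarity_cost_def using assms
  by (intro sum.cong refl star_cost_eq_sum[symmetric]) auto

lemma similarity_cost_le_star_cost:
  assumes x: "x \<in> {1..n} \<rightarrow> M" and r: "r \<in> {1..n}"
  shows "similarity_cost d n x \<le> 2 * real n * star_cost d n r x"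
proof -
  have "similarity_cost d n x \<le> (\<Sum>i\<in>{1..n}. \<Sum>j\<in>{1..n}. d (x r) (x i) + d (x r) (x j))"
    unfolding similarity_cost_def
  proof (intro sum_mono)
    fix i j assume "i \<in> {1..n}" "j \<in> {1..n}"
    then show "d (x i) (x j) \<le> d (x r) (x i) + d (x r) (x j)"
      using x r by (intro triangle'') (auto simp: Pi_iff)
  qed
  \<comment> \<open>Each distance from the centre is counted \<open>n\<close> times as the leg to
    \<open>x i\<close> and \<open>n\<close> times as the leg to \<open>x j\<close>.\<close>
  also have "\<dots> = 2 * real n * (\<Sum>j\<in>{1..n}. d (x r) (x j))"
    by (simp add: sum.distrib flip: sum_distrib_left)
  also have "\<dots> = 2 * real n * star_cost d n r x"
    using x r by (subst star_cost_eq_sum) auto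
  finally show ?thesis .
qed

end

theorem theorem1:
  fixes X :: "'a set" and d :: "'a \<Rightarrow> 'a \<Rightarrow> real" and n :: nat
    and S :: "nat \<Rightarrow> 'a set" and x_opt x_hat :: "nat \<Rightarrow> 'a"
  assumes "Metric_space X d"
    and "n \<ge> 1"
    and "\<And>i. i \<in> {1..n} \<Longrightarrow> S i \<subseteq> X \<and> finite (S i) \<and> S i \<noteq> {}"
    and "is_arg_min (similarity_cost d n) (\<lambda>x. x \<in> Pi\<^sub>E {1..n} S) x_opt"
    and "algorithm_output d n S x_hat"
  shows "similarity_cost d n x_hat \<le> 2 * similarity_cost d n x_opt"
proof -
  interpret Metric_space X d by fact
  from assms(5) obtain xs r where choice: "\<And>q. q \<in> {1..n} \<Longrightarrow> star_choice d n S q (xs q)"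
    and r: "r \<in> {1..n}" and x_hat: "x_hat = xs r"
    and best: "\<And>q. q \<in> {1..n} \<Longrightarrow> star_cost d n r (xs r) \<le> star_cost d n q (xs q)"
    unfolding algorithm_output_def is_arg_min_linorder by blast
  have opt: "x_opt \<in> Pi\<^sub>E {1..n} S"
    using assms(4) by (simp add: is_arg_min_def)
  have in_X: "x \<in> {1..n} \<rightarrow> X" if "x \<in> Pi\<^sub>E {1..n} S" for x
    using that assms(3) by blast
  have "xs r \<in> {1..n} \<rightarrow> X"
    using choice[OF r] by (intro in_X) (simp add: star_choice_def)
  \<comment> \<open>The factor \<open>n\<close> is written as a sum of a constant over
    \<open>q\<close>, so that the averaging argument becomes a termwise comparison without
    division.\<close>
  then have "similarity_cost d n x_hat \<le> 2 * (\<Sum>q\<in>{1..n}. star_cost d n r (xs r))"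
    using similarity_cost_le_star_cost r x_hat by (simp add: mult.assoc)
  also have "\<dots> \<le> 2 * (\<Sum>q\<in>{1..n}. star_cost d n q x_opt)"
  proof (intro mult_left_mono sum_mono)
    fix q assume q: "q \<in> {1..n}"
    \<comment> \<open>The same competitor \<open>x_opt\<close> is used for every centre
      \<open>q\<close>, so the bounds add up to its full cost.\<close>
    have "star_cost d n q (xs q) \<le> star_cost d n q x_opt"
      using choice[OF q] opt q assms(3) by (intro star_choice_minimizes) auto
    with best[OF q] show "star_cost d n r (xs r) \<le> star_cost d n q x_opt"
      by (rule order_trans)
  qed simp
  also have "\<dots> = 2 * similarity_cost d n x_opt"
    using in_X[OF opt] by (simp add: similarity_cost_eq_sum_star_cost)
  finally show ?thesis .
qed

end
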